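(* Let $K$ be a field of characteristic zero, let $n=2r+1$ with $r\ge0$ an integer, and let $X_3$ be the $n\times n$ tridiagonal skew-symmetric matrix whose $(i,i+1)$ entry is an indeterminate $x_{i\,i+1}$ and whose $(i+1,i)$ entry is $-x_{i\,i+1}$ for $1\le i\le n-1$, all other entries being $0$. Then there is an unmixed bipartite graph, with vertices labelled by the indeterminates $x_{12},x_{23},\dots,x_{n-1\,n}$, whose vertex cover ideal in $K[x_{12},x_{23},\dots,x_{n-1\,n}]$ is $\mathrm{Pf}_{n-1}(X_3)$.
   Context: For a skew-symmetric matrix $M$ of even order, $\mathrm{Pf}(M)$ is the Pfaffian, with $\mathrm{Pf}(M)^2=\det M$ (the Pfaffian of the empty matrix is $1$). $\mathrm{Pf}_{n-1}(X_3)$ is the ideal of $K[x_{12},\dots,x_{n-1\,n}]$ generated by the Pfaffians of the $n$ submatrices obtained from $X_3$ by deleting the $\ell$-th row and $\ell$-th column, $\ell=1,\dots,n$. The vertex cover ideal of a finite simple graph $G$ whose vertices are indeterminates is the ideal generated by the monomials $\prod_{v\in C}v$, where $C$ ranges over the minimal vertex covers of $G$. A graph is unmixed if all its minimal vertex covers have the same cardinality. *)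

theory Defs
  imports
    "HOL-Library.Poly_Mapping"
    "HOL-Algebra.Ideal"
    "Jordan_Normal_Form.Determinant"
    "Graph_Theory.Pair_Digraph"
begin

section \<open>Polynomial rings\<close>

text \<open>
  A polynomial maps each monomial (an exponent vector \<open>'v \<Rightarrow>\<^sub>0 nat\<close>) to its coefficient; the
  ring operations of \<open>Poly_Mapping\<close> on this type are those of polynomials. The type has
  one indeterminate for every \<open>v :: 'v\<close>, so \<open>K[v. v \<in> V]\<close> is carved out by a carrier.
\<close>

type_synonym ('v, 'k) mpoly = "('v \<Rightarrow>\<^sub>0 nat) \<Rightarrow>\<^sub>0 'k"

definition Var :: "'v \<Rightarrow> ('v, 'k::comm_ring_1) mpoly" where
  "Var v = Poly_Mapping.single (Poly_Mapping.single v 1) 1"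

definition indets :: "('v, 'k::comm_ring_1) mpoly \<Rightarrow> 'v set" where
  "indets p = (\<Union>m\<in>Poly_Mapping.keys p. Poly_Mapping.keys m)"

definition mpoly_ring :: "'v set \<Rightarrow> ('v, 'k::comm_ring_1) mpoly ring" where
  "mpoly_ring V = \<lparr>carrier = {p. indets p \<subseteq> V}, monoid.mult = (*), one = 1, zero = 0, add = (+)\<rparr>"

lemma mpoly_ring_simps [simp]:
  "p \<in> carrier (mpoly_ring V) \<longleftrightarrow> indets p \<subseteq> V"
  "monoid.mult (mpoly_ring V) = (*)" "one (mpoly_ring V) = 1"
  "zero (mpoly_ring V) = 0" "add (mpoly_ring V) = (+)"
  by (auto simp: mpoly_ring_def)

lemma indets_zero [simp]: "indets 0 = {}"
  and indets_one [simp]: "indets 1 = {}"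
  and indets_Var [simp]: "indets (Var v :: ('v, 'k::comm_ring_1) mpoly) = {v}"
  by (auto simp: indets_def Var_def)

lemma indets_uminus [simp]: "indets (- p) = indets p"
  by (auto simp: indets_def in_keys_iff)

lemma indets_add: "indets (p + q) \<subseteq> indets p \<union> indets q"
  using Poly_Mapping.keys_add[of p q] by (fastforce simp: indets_def)

lemma indets_mult: "indets (p * q) \<subseteq> indets p \<union> indets q"
proof
  fix v assume "v \<in> indets (p * q)"
  then obtain m where m: "m \<in> Poly_Mapping.keys (p * q)" "v \<in> Poly_Mapping.keys m"
    by (auto simp: indets_def)
  then obtain a b where "a \<in> Poly_Mapping.keys p" "b \<in> Poly_Mapping.keys q" "m = a + b"
    using Poly_Mapping.keys_mult[of p q] by blast
  then show "v \<in> indets p \<union> indets q"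
    using m(2) Poly_Mapping.keys_add[of a b] by (fastforce simp: indets_def)
qed

lemma indets_sum: "(\<And>i. i \<in> A \<Longrightarrow> indets (f i) \<subseteq> V) \<Longrightarrow> indets (sum f A) \<subseteq> V"
proof (induction A rule: infinite_finite_induct)
  case (insert x F)
  then show ?case using indets_add[of "f x" "sum f F"] by auto
qed auto

lemma indets_prod: "(\<And>i. i \<in> A \<Longrightarrow> indets (f i) \<subseteq> V) \<Longrightarrow> indets (prod f A) \<subseteq> V"
proof (induction A rule: infinite_finite_induct)
  case (insert x F)
  then show ?case using indets_mult[of "f x" "prod f F"] by auto
qed auto

lemma mpoly_ring_cring: "cring (mpoly_ring V)"
proof (rule cringI)
  show "abelian_group (mpoly_ring V)"
  proof (rule abelian_groupI, goal_cases)
    case (6 x)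
    then show ?case by (intro bexI[of _ "- x"]) auto
  qed (auto simp: algebra_simps dest!: indets_add[THEN subsetD])
  show "Group.comm_monoid (mpoly_ring V)"
    by (rule comm_monoidI) (auto simp: algebra_simps dest!: indets_mult[THEN subsetD])
qed (auto simp: algebra_simps)


section \<open>Vertex covers\<close>

text \<open>
  Finite simple graphs are \<open>pair_graph\<close>s: finite, loop-free and symmetric, so that the
  edge \<open>{u, v}\<close> is the pair of arcs \<open>(u, v)\<close>, \<open>(v, u)\<close>.
\<close>

definition vertex_cover :: "'v pair_pre_digraph \<Rightarrow> 'v set \<Rightarrow> bool" where
  "vertex_cover G C \<longleftrightarrow> C \<subseteq> pverts G \<and> (\<forall>(u, v)\<in>parcs G. u \<in> C \<or> v \<in> C)"

definition minimal_vertex_cover :: "'v pair_pre_digraph \<Rightarrow> 'v set \<Rightarrow> bool" where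
  "minimal_vertex_cover G C \<longleftrightarrow> vertex_cover G C \<and> (\<forall>D. D \<subset> C \<longrightarrow> \<not> vertex_cover G D)"

definition unmixed :: "'v pair_pre_digraph \<Rightarrow> bool" where
  "unmixed G \<longleftrightarrow>
    (\<forall>C D. minimal_vertex_cover G C \<longrightarrow> minimal_vertex_cover G D \<longrightarrow> card C = card D)"

definition bipartite :: "'v pair_pre_digraph \<Rightarrow> bool" where
  "bipartite G \<longleftrightarrow> (\<exists>A B. A \<union> B = pverts G \<and> A \<inter> B = {} \<and>
    (\<forall>(u, v)\<in>parcs G. (u \<in> A \<and> v \<in> B) \<or> (u \<in> B \<and> v \<in> A)))"

definition vertex_cover_ideal :: "'v pair_pre_digraph \<Rightarrow> ('v, 'k::comm_ring_1) mpoly set" where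
  "vertex_cover_ideal G =
    Idl\<^bsub>mpoly_ring (pverts G)\<^esub> {\<Prod>v\<in>C. Var v | C. minimal_vertex_cover G C}"

lemma vertex_cover_monomials_in_carrier:
  "{\<Prod>v\<in>C. Var v | C. minimal_vertex_cover G C} \<subseteq> carrier (mpoly_ring (pverts G))"
proof clarsimp
  fix C :: "'a set" and x
  assume C: "minimal_vertex_cover G C" and x: "x \<in> indets (\<Prod>v\<in>C. Var v :: ('a, 'b) mpoly)"
  have "indets (\<Prod>v\<in>C. Var v :: ('a, 'b) mpoly) \<subseteq> pverts G"
    using C by (intro indets_prod) (auto simp: minimal_vertex_cover_def vertex_cover_def)
  with x show "x \<in> pverts G" by blast
qed


section \<open>Pfaffians\<close>

text \<open>
  The sum runs over the perfect matchings
  \<open>{{\<sigma> 0, \<sigma> 1}, \<dots>, {\<sigma> (2 m - 2), \<sigma> (2 m - 1)}}\<close> of the index set \<open>{0..<2 m}\<close>, each represented by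
  the one permutation \<open>\<sigma>\<close> that lists every pair increasingly and the pairs by increasing first
  element. Only meaningful for skew-symmetric matrices of even order \<open>2 m\<close>.
\<close>

definition pfaffian :: "'a::comm_ring_1 mat \<Rightarrow> 'a" where
  "pfaffian M = (let m = dim_row M div 2 in
    \<Sum>\<sigma> | \<sigma> permutes {0..<2 * m} \<and> (\<forall>i<m. \<sigma> (2 * i) < \<sigma> (2 * i + 1)) \<and>
        (\<forall>i. i + 1 < m \<longrightarrow> \<sigma> (2 * i) < \<sigma> (2 * (i + 1))).
      signof \<sigma> * (\<Prod>i<m. M $$ (\<sigma> (2 * i), \<sigma> (2 * i + 1))))"

lemma pfaffian_empty: "dim_row M = 0 \<Longrightarrow> pfaffian M = 1"
  by (simp add: pfaffian_def)

lemma pfaffian_2: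
  assumes "dim_row M = 2"
  shows "pfaffian M = M $$ (0, 1)"
proof -
  have "{\<sigma>. \<sigma> permutes {0..<2} \<and> \<sigma> 0 < \<sigma> 1} = {id :: nat \<Rightarrow> nat}"
  proof safe
    fix \<sigma> :: "nat \<Rightarrow> nat" assume p: "\<sigma> permutes {0..<2}" and lt: "\<sigma> 0 < \<sigma> 1"
    have "\<sigma> 0 < 2" "\<sigma> 1 < 2" using permutes_in_image[OF p, of 0] permutes_in_image[OF p, of 1] by auto
    with lt have "\<sigma> 0 = 0" "\<sigma> 1 = 1" by linarith+
    moreover have "\<sigma> x = x" if "x \<ge> 2" for x
      using p that by (simp add: permutes_not_in)
    ultimately show "\<sigma> = id" by (metis One_nat_def eq_id_iff less_2_cases not_le)
  qed (auto simp: permutes_id)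
  then show ?thesis using assms by (simp add: pfaffian_def)
qed

text \<open>The indeterminate \<open>x\<^bsub>i i+1\<^esub>\<close> is indexed by the pair \<open>(i, i + 1)\<close>, with \<open>1 \<le> i \<le> n - 1\<close>.\<close>

definition x_vars :: "nat \<Rightarrow> (nat \<times> nat) set" where
  "x_vars n = {(i, i + 1) | i. 1 \<le> i \<and> i + 1 \<le> n}"

text \<open>Matrix positions count from 0, whereas the indices of the indeterminates count from 1.\<close>

definition X3 :: "nat \<Rightarrow> (nat \<times> nat, 'k::comm_ring_1) mpoly mat" where
  "X3 n = mat n n (\<lambda>(i, j).
    if j = i + 1 then Var (i + 1, j + 1)
    else if i = j + 1 then - Var (j + 1, i + 1)
    else 0)"

definition pfaffian_ideal_X3 :: "nat \<Rightarrow> (nat \<times> nat, 'k::comm_ring_1) mpoly set" where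
  "pfaffian_ideal_X3 n =
    Idl\<^bsub>mpoly_ring (x_vars n)\<^esub> {pfaffian (mat_delete (X3 n) l l) | l. l < n}"

lemma X3_skew_symmetric: "transpose_mat (X3 n) = - X3 n"
  by (rule eq_matI) (auto simp: X3_def)

lemma indets_X3: "i < n \<Longrightarrow> j < n \<Longrightarrow> indets (X3 n $$ (i, j)) \<subseteq> x_vars n"
  by (auto simp: X3_def x_vars_def)

lemma pfaffians_X3_in_carrier:
  assumes "odd n"
  shows "{pfaffian (mat_delete (X3 n) l l) | l. l < n} \<subseteq> carrier (mpoly_ring (x_vars n))"
proof -
  have "indets (pfaffian (mat_delete (X3 n :: (nat \<times> nat, 'a) mpoly mat) l l)) \<subseteq> x_vars n"
    if l: "l < n" for l
  proof -
    let ?M = "mat_delete (X3 n :: (nat \<times> nat, 'a) mpoly mat) l l"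
    have dims: "dim_row ?M = n - 1" "dim_row (X3 n) = n" "dim_col (X3 n) = n"
      by (auto simp: mat_delete_def X3_def)
    have M: "indets (?M $$ (i, j)) \<subseteq> x_vars n" if "i < n - 1" "j < n - 1" for i j
      using that by (auto simp: mat_delete_def dims intro!: indets_X3[THEN subsetD])
    have S: "indets (signof \<sigma> * p) \<subseteq> V" if "indets p \<subseteq> V"
      for \<sigma> and p :: "(nat \<times> nat, 'a) mpoly" and V
      using that by (auto simp: sign_def)
    obtain b where n: "n - 1 = 2 * b" using assms by (auto elim: oddE)
    show ?thesis
      unfolding pfaffian_def Let_def dims n
    proof (intro indets_sum S indets_prod M)
      fix \<sigma> i assume "\<sigma> \<in> {\<sigma>. \<sigma> permutes {0..<2 * (2 * b div 2)} \<and>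
          (\<forall>i<2 * b div 2. \<sigma> (2 * i) < \<sigma> (2 * i + 1)) \<and>
          (\<forall>i. i + 1 < 2 * b div 2 \<longrightarrow> \<sigma> (2 * i) < \<sigma> (2 * (i + 1)))}"
        and i: "i \<in> {..<2 * b div 2}"
      then have p: "\<sigma> permutes {0..<2 * b}" by simp
      show "\<sigma> (2 * i) < n - 1" "\<sigma> (2 * i + 1) < n - 1"
        using permutes_in_image[OF p, of "2 * i"] permutes_in_image[OF p, of "2 * i + 1"] i n
        by auto
    qed
  qed
  then show ?thesis by auto
qed

end

theory Submission
  imports Defs
begin

text \<open>
  In the Pfaffian of a matrix that is zero above its first superdiagonal, a perfect matching
  contributes only if every pair consists of two consecutive indices, and
  \<open>{0, 1}, {2, 3}, \<dots>\<close> is the only such matching; hence the Pfaffian is a single product of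
  superdiagonal entries (\<open>pfaffian_zero_above_superdiagonal\<close>). For \<open>i < r\<close> write
  \<open>a\<^sub>i\<close> for the indeterminate with index \<open>(2 * i + 1, 2 * i + 2)\<close> and \<open>b\<^sub>i\<close> for the one
  with index \<open>(2 * i + 2, 2 * i + 3)\<close>. Deleting row and column \<open>2 * k\<close>, counted from 0, splits
  the tridiagonal matrix into two blocks of even order, and the Pfaffian is
  \<open>a\<^sub>0 \<cdots> a\<^bsub>k-1\<^esub> b\<^sub>k \<cdots> b\<^bsub>r-1\<^esub>\<close>; deleting row and column \<open>2 * k + 1\<close>
  leaves two blocks of odd order, and the Pfaffian is zero.

  The sets \<open>{a\<^sub>i. i < k} \<union> {b\<^sub>i. i \<ge> k}\<close> determine the graph: \<open>a\<^sub>i\<close> and \<open>b\<^sub>j\<close> can be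
  adjacent, with all these sets as covers, exactly if \<open>i \<le> j\<close>. In the graph with all these edges a
  cover that omits \<open>a\<^sub>k\<close> contains every \<open>b\<^sub>j\<close> with \<open>j \<ge> k\<close>. Choosing \<open>k\<close> least shows that every
  cover contains one of these sets. As they all have \<open>r\<close> elements, none properly contains another, so
  they are precisely the minimal vertex covers (\<open>minimal_vertex_cover_iff_staircase\<close>).
\<close>

section \<open>Pfaffians of tridiagonal matrices\<close>

text \<open>
  A permutation of the kind summed over in the Pfaffian, all of whose pairs are consecutive, can
  never fall behind the identity: the next pair starts later than the current one and not at its
  second element.
\<close>

lemma consecutive_pairs_imp_id:
  fixes \<sigma> :: "nat \<Rightarrow> nat"
  assumes perm: "\<sigma> permutes {0..<2 * m}"
    and consecutive: "\<And>i. i < m \<Longrightarrow> \<sigma> (2 * i + 1) = \<sigma> (2 * i) + 1"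
    and increasing: "\<And>i. i + 1 < m \<Longrightarrow> \<sigma> (2 * i) < \<sigma> (2 * (i + 1))"
  shows "\<sigma> = id"
proof -
  have ge: "2 * i \<le> \<sigma> (2 * i)" if "i < m" for i
    using that
  proof (induction i)
    case (Suc i)
    have "\<sigma> (2 * (i + 1)) \<noteq> \<sigma> (2 * i + 1)"
      by (simp add: inj_eq[OF permutes_inj[OF perm]])
    then show ?case
      using Suc consecutive[of i] increasing[of i] by simp
  qed simp
  have "x \<le> \<sigma> x" if "x \<in> {0..<2 * m}" for x
  proof (cases "even x")
    case True
    then obtain i where "x = 2 * i" by (elim evenE)
    then show ?thesis using ge[of i] that by simp
  next
    case False
    then obtain i where "x = 2 * i + 1" by (elim oddE)
    then show ?thesis using ge[of i] consecutive[of i] that by simp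
  qed
  then show ?thesis
    using permutes_natset_ge[OF perm] by blast
qed

lemma pfaffian_zero_above_superdiagonal:
  fixes M :: "'a::comm_ring_1 mat"
  assumes dim: "dim_row M = 2 * m"
    and zero: "\<And>i j. i + 1 < j \<Longrightarrow> j < 2 * m \<Longrightarrow> M $$ (i, j) = 0"
  shows "pfaffian M = (\<Prod>i<m. M $$ (2 * i, 2 * i + 1))"
proof -
  let ?P = "{\<sigma>. \<sigma> permutes {0..<2 * m} \<and> (\<forall>i<m. \<sigma> (2 * i) < \<sigma> (2 * i + 1)) \<and>
        (\<forall>i. i + 1 < m \<longrightarrow> \<sigma> (2 * i) < \<sigma> (2 * (i + 1)))}"
  let ?t = "\<lambda>\<sigma>. signof \<sigma> * (\<Prod>i<m. M $$ (\<sigma> (2 * i), \<sigma> (2 * i + 1)))"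
  have vanish: "?t \<sigma> = 0" if "\<sigma> \<in> ?P - {id}" for \<sigma>
  proof -
    from that have perm: "\<sigma> permutes {0..<2 * m}"
      and pairs: "\<forall>i<m. \<sigma> (2 * i) < \<sigma> (2 * i + 1)"
      and firsts: "\<forall>i. i + 1 < m \<longrightarrow> \<sigma> (2 * i) < \<sigma> (2 * (i + 1))"
      and "\<sigma> \<noteq> id"
      by simp_all
    have "\<exists>i<m. \<sigma> (2 * i + 1) \<noteq> \<sigma> (2 * i) + 1"
    proof (rule ccontr)
      assume "\<not> (\<exists>i<m. \<sigma> (2 * i + 1) \<noteq> \<sigma> (2 * i) + 1)"
      then have "\<sigma> = id"
        using firsts by (intro consecutive_pairs_imp_id[OF perm]) simp_all
      with \<open>\<sigma> \<noteq> id\<close> show False ..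
    qed
    then obtain i where i: "i < m" "\<sigma> (2 * i) + 1 < \<sigma> (2 * i + 1)"
      using pairs by (metis Suc_eq_plus1 Suc_lessI)
    moreover have "\<sigma> (2 * i + 1) < 2 * m"
      using permutes_in_image[OF perm, of "2 * i + 1"] i(1) by simp
    ultimately have "M $$ (\<sigma> (2 * i), \<sigma> (2 * i + 1)) = 0"
      by (intro zero)
    then have "(\<Prod>i<m. M $$ (\<sigma> (2 * i), \<sigma> (2 * i + 1))) = 0"
      using i(1) by (intro prod_zero) auto
    then show ?thesis by simp
  qed
  have fin: "finite ?P"
    by (rule finite_subset[OF _ finite_permutations[of "{0..<2 * m}"]]) auto
  have "pfaffian M = sum ?t ?P"
    by (simp add: pfaffian_def dim)
  also have "\<dots> = sum ?t {id}"
    using fin vanish by (intro sum.mono_neutral_right) (auto simp: permutes_id)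
  finally show ?thesis by simp
qed


section \<open>The Pfaffians of the deleted submatrices\<close>

text \<open>
  The \<open>i\<close>-th factor of the \<open>k\<close>-th Pfaffian: \<open>a\<^sub>i\<close> on the first \<open>k\<close> stairs and \<open>b\<^sub>i\<close>
  from then on.
\<close>

definition stair :: "nat \<Rightarrow> nat \<Rightarrow> nat \<times> nat" where
  "stair k i = (if i < k then (2 * i + 1, 2 * i + 2) else (2 * i + 2, 2 * i + 3))"

definition staircase :: "nat \<Rightarrow> nat \<Rightarrow> (nat \<times> nat) set" where
  "staircase r k = stair k ` {..<r}"

lemma inj_stair: "inj_on (stair k) A"
  by (rule inj_on_inverseI[where g = "\<lambda>v. (fst v - 1) div 2"]) (simp add: stair_def)

lemma card_staircase: "card (staircase r k) = r"
  by (simp add: staircase_def card_image inj_stair)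

lemma finite_staircase: "finite (staircase r k)"
  by (simp add: staircase_def)

lemma pfaffian_delete_eq_prod:
  assumes l: "l < 2 * r + 1"
  shows "pfaffian (mat_delete (X3 (2 * r + 1) :: (nat \<times> nat, 'k::comm_ring_1) mpoly mat) l l)
    = (\<Prod>i<r. mat_delete (X3 (2 * r + 1)) l l $$ (2 * i, 2 * i + 1))"
  by (rule pfaffian_zero_above_superdiagonal) (auto simp: mat_delete_def X3_def)

lemma pfaffian_delete_even:
  assumes k: "k \<le> r"
  shows "pfaffian (mat_delete (X3 (2 * r + 1) :: (nat \<times> nat, 'k::comm_ring_1) mpoly mat)
      (2 * k) (2 * k)) = (\<Prod>v\<in>staircase r k. Var v)"
proof -
  let ?M = "mat_delete (X3 (2 * r + 1) :: (nat \<times> nat, 'k) mpoly mat) (2 * k) (2 * k)"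
  have entry: "?M $$ (2 * i, 2 * i + 1) = Var (stair k i)" if "i < r" for i
  proof (cases "i < k")
    case True
    then show ?thesis using that by (simp add: mat_delete_def X3_def stair_def)
  next
    case False
    then show ?thesis
      using that by (simp add: mat_delete_def X3_def stair_def eval_nat_numeral)
  qed
  have "pfaffian ?M = (\<Prod>i<r. ?M $$ (2 * i, 2 * i + 1))"
    using k by (intro pfaffian_delete_eq_prod) simp
  also have "\<dots> = (\<Prod>i<r. Var (stair k i))"
    by (rule prod.cong[OF refl], rule entry) simp
  also have "\<dots> = (\<Prod>v\<in>staircase r k. Var v)"
    by (simp add: staircase_def prod.reindex inj_stair)
  finally show ?thesis .
qed

text \<open>
  Here the index pair \<open>(2 * k, 2 * k + 1)\<close> straddles the deleted index, so its entry comes from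
  beyond the superdiagonal.
\<close>

lemma pfaffian_delete_odd:
  assumes k: "k < r"
  shows "pfaffian (mat_delete (X3 (2 * r + 1) :: (nat \<times> nat, 'k::comm_ring_1) mpoly mat)
      (2 * k + 1) (2 * k + 1)) = 0"
proof -
  have "mat_delete (X3 (2 * r + 1) :: (nat \<times> nat, 'k) mpoly mat) (2 * k + 1) (2 * k + 1)
      $$ (2 * k, 2 * k + 1) = 0"
    using k by (auto simp: mat_delete_def X3_def)
  then have "(\<Prod>i<r. mat_delete (X3 (2 * r + 1) :: (nat \<times> nat, 'k) mpoly mat)
      (2 * k + 1) (2 * k + 1) $$ (2 * i, 2 * i + 1)) = 0"
    using k by (intro prod_zero) auto
  then show ?thesis
    using k by (subst pfaffian_delete_eq_prod) auto
qed

lemma genideal_ignores_zero: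
  assumes "S \<subseteq> T" "T \<subseteq> insert \<zero>\<^bsub>R\<^esub> S"
  shows "Idl\<^bsub>R\<^esub> T = Idl\<^bsub>R\<^esub> S"
proof -
  have "T \<subseteq> I \<longleftrightarrow> S \<subseteq> I" if "ideal I R" for I
    using assms additive_subgroup.zero_closed[OF ideal.axioms(1)[OF that]] by blast
  then show ?thesis
    unfolding genideal_def by (metis (no_types, lifting))
qed

lemma pfaffian_ideal_X3_eq:
  "(pfaffian_ideal_X3 (2 * r + 1) :: (nat \<times> nat, 'k::comm_ring_1) mpoly set)
    = Idl\<^bsub>mpoly_ring (x_vars (2 * r + 1))\<^esub> {\<Prod>v\<in>staircase r k. Var v | k. k \<le> r}"
proof -
  let ?R = "mpoly_ring (x_vars (2 * r + 1)) :: (nat \<times> nat, 'k) mpoly ring"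
  let ?pf = "\<lambda>l. pfaffian (mat_delete (X3 (2 * r + 1) :: (nat \<times> nat, 'k) mpoly mat) l l)"
  let ?S = "{\<Prod>v\<in>staircase r k. Var v :: (nat \<times> nat, 'k) mpoly | k. k \<le> r}"
  have "?pf l \<in> insert 0 ?S" if l: "l < 2 * r + 1" for l
  proof (cases "even l")
    case True
    then obtain k where k: "l = 2 * k" by (elim evenE)
    then have "k \<le> r" using l by simp
    from pfaffian_delete_even[OF this] this show ?thesis unfolding k by blast
  next
    case False
    then obtain k where k: "l = 2 * k + 1" by (elim oddE)
    then have "k < r" using l by simp
    from pfaffian_delete_odd[OF this] show ?thesis unfolding k insert_iff by (rule disjI1)
  qed
  then have "{?pf l | l. l < 2 * r + 1} \<subseteq> insert \<zero>\<^bsub>?R\<^esub> ?S"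
    unfolding mpoly_ring_simps by blast
  moreover have "?S \<subseteq> {?pf l | l. l < 2 * r + 1}"
  proof clarify
    fix k assume k: "k \<le> r"
    show "\<exists>l. (\<Prod>v\<in>staircase r k. Var v) = ?pf l \<and> l < 2 * r + 1"
      using k pfaffian_delete_even[OF k, where 'k = 'k] by (intro exI[of _ "2 * k"]) simp
  qed
  ultimately show ?thesis
    unfolding pfaffian_ideal_X3_def by (intro genideal_ignores_zero)
qed


section \<open>The staircase graph\<close>

text \<open>
  For indeterminates this is the condition that \<open>u\<close> is some \<open>a\<^sub>i\<close> and \<open>v\<close> some \<open>b\<^sub>j\<close> with \<open>i \<le> j\<close>:
  the first components are \<open>2 * i + 1\<close> and \<open>2 * j + 2\<close>, and \<open>2 * i + 1 < 2 * j + 2\<close> if and only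
  if \<open>i \<le> j\<close>.
\<close>

definition staircase_edge :: "nat \<times> nat \<Rightarrow> nat \<times> nat \<Rightarrow> bool" where
  "staircase_edge u v \<longleftrightarrow> odd (fst u) \<and> even (fst v) \<and> fst u < fst v"

definition staircase_graph :: "nat \<Rightarrow> (nat \<times> nat) pair_pre_digraph" where
  "staircase_graph n = \<lparr>pverts = x_vars n,
    parcs = {(u, v). u \<in> x_vars n \<and> v \<in> x_vars n \<and> (staircase_edge u v \<or> staircase_edge v u)}\<rparr>"

lemma pverts_staircase_graph [simp]: "pverts (staircase_graph n) = x_vars n"
  by (simp add: staircase_graph_def)

lemma parcs_staircase_graph [simp]: "(u, v) \<in> parcs (staircase_graph n) \<longleftrightarrow>
    u \<in> x_vars n \<and> v \<in> x_vars n \<and> (staircase_edge u v \<or> staircase_edge v u)"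
  by (simp add: staircase_graph_def)

lemma finite_x_vars: "finite (x_vars n)"
  by (rule finite_subset[of _ "{..n} \<times> {..n}"]) (auto simp: x_vars_def)

lemma pair_graph_staircase_graph: "pair_graph (staircase_graph n)"
proof
  show "finite (parcs (staircase_graph n))"
    by (rule finite_subset[of _ "x_vars n \<times> x_vars n"]) (auto simp: finite_x_vars)
  show "symmetric (with_proj (staircase_graph n))"
    by (auto simp: symmetric_def intro!: symI)
qed (auto simp: finite_x_vars staircase_edge_def)

lemma bipartite_staircase_graph: "bipartite (staircase_graph n)"
  unfolding bipartite_def
  by (rule exI[of _ "{u \<in> x_vars n. odd (fst u)}"], rule exI[of _ "{u \<in> x_vars n. even (fst u)}"])
    (auto simp: staircase_edge_def)

lemma mem_x_varsE:
  assumes "u \<in> x_vars (2 * r + 1)"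
  obtains (odd_start) i where "i < r" "u = (2 * i + 1, 2 * i + 2)"
  | (even_start) i where "i < r" "u = (2 * i + 2, 2 * i + 3)"
proof -
  obtain p where p: "u = (p, p + 1)" "1 \<le> p" "p < 2 * r + 1"
    using assms by (auto simp: x_vars_def)
  show thesis
  proof (cases "even p")
    case True
    then obtain j where "p = 2 * j" by (elim evenE)
    then show thesis using p even_start[of "j - 1"] by (cases j) simp_all
  next
    case False
    then obtain i where "p = 2 * i + 1" by (elim oddE)
    then show thesis using p odd_start[of i] by simp
  qed
qed

lemma stair_odd_start: "i < k \<Longrightarrow> i < r \<Longrightarrow> (2 * i + 1, 2 * i + 2) \<in> staircase r k"
  unfolding staircase_def by (rule image_eqI[of _ _ i]) (auto simp: stair_def)

lemma stair_even_start: "k \<le> i \<Longrightarrow> i < r \<Longrightarrow> (2 * i + 2, 2 * i + 3) \<in> staircase r k"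
  unfolding staircase_def by (rule image_eqI[of _ _ i]) (auto simp: stair_def)

lemma staircase_edge_covered:
  assumes "u \<in> x_vars (2 * r + 1)" "v \<in> x_vars (2 * r + 1)" "staircase_edge u v"
  shows "u \<in> staircase r k \<or> v \<in> staircase r k"
proof -
  obtain i where i: "i < r" "u = (2 * i + 1, 2 * i + 2)"
    using assms(1,3) by (cases rule: mem_x_varsE) (auto simp: staircase_edge_def)
  obtain j where j: "j < r" "v = (2 * j + 2, 2 * j + 3)"
    using assms(2,3) by (cases rule: mem_x_varsE) (auto simp: staircase_edge_def)
  have "i \<le> j"
    using assms(3) i j by (simp add: staircase_edge_def)
  then show ?thesis
    using i j stair_odd_start[of i k r] stair_even_start[of k j r] by (cases "i < k") auto
qed

lemma vertex_cover_staircase: "vertex_cover (staircase_graph (2 * r + 1)) (staircase r k)"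
  unfolding vertex_cover_def
proof (intro conjI)
  show "staircase r k \<subseteq> pverts (staircase_graph (2 * r + 1))"
    by (auto simp: staircase_def stair_def x_vars_def)
  have "u \<in> staircase r k \<or> v \<in> staircase r k"
    if "(u, v) \<in> parcs (staircase_graph (2 * r + 1))" for u v
    using that staircase_edge_covered[of u r v k] staircase_edge_covered[of v r u k]
    unfolding parcs_staircase_graph by blast
  then show "\<forall>(u, v)\<in>parcs (staircase_graph (2 * r + 1)). u \<in> staircase r k \<or> v \<in> staircase r k"
    by blast
qed

text \<open>
  Take the least \<open>k\<close> such that the cover omits \<open>a\<^sub>k\<close>: the edges from \<open>a\<^sub>k\<close> to the \<open>b\<^sub>j\<close>
  with \<open>j \<ge> k\<close> force all these \<open>b\<^sub>j\<close> into the cover.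
\<close>

lemma vertex_cover_contains_staircase:
  assumes C: "vertex_cover (staircase_graph (2 * r + 1)) C"
  obtains k where "k \<le> r" "staircase r k \<subseteq> C"
proof -
  \<comment> \<open>The bound \<open>r\<close> is the default for a cover that omits none of the \<open>a\<^sub>i\<close>.\<close>
  define k where "k = (LEAST i. i = r \<or> (2 * i + 1, 2 * i + 2) \<notin> C)"
  have k: "k = r \<or> (2 * k + 1, 2 * k + 2) \<notin> C"
    unfolding k_def by (rule LeastI[of _ r]) simp
  have "k \<le> r"
    unfolding k_def by (rule Least_le) simp
  moreover have "stair k i \<in> C" if i: "i < r" for i
  proof (cases "i < k")
    case True
    then have "(2 * i + 1, 2 * i + 2) \<in> C"
      using not_less_Least[of i "\<lambda>i. i = r \<or> (2 * i + 1, 2 * i + 2) \<notin> C"] by (auto simp: k_def)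
    then show ?thesis using True by (simp add: stair_def)
  next
    case False
    let ?a = "(2 * k + 1, 2 * k + 2)" and ?b = "(2 * i + 2, 2 * i + 3)"
    have "?a \<notin> C" using k False i by auto
    moreover have "(?a, ?b) \<in> parcs (staircase_graph (2 * r + 1))"
      using False i by (auto simp: staircase_edge_def x_vars_def)
    ultimately have "?b \<in> C" using C unfolding vertex_cover_def by blast
    then show ?thesis using False by (simp add: stair_def)
  qed
  ultimately show thesis using that by (auto simp: staircase_def)
qed

lemma minimal_vertex_cover_iff_staircase:
  "minimal_vertex_cover (staircase_graph (2 * r + 1)) C \<longleftrightarrow> (\<exists>k\<le>r. C = staircase r k)"
proof
  assume C: "minimal_vertex_cover (staircase_graph (2 * r + 1)) C"
  then obtain k where "k \<le> r" "staircase r k \<subseteq> C"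
    using vertex_cover_contains_staircase unfolding minimal_vertex_cover_def by blast
  then show "\<exists>k\<le>r. C = staircase r k"
    using C vertex_cover_staircase[of r k] unfolding minimal_vertex_cover_def by blast
next
  assume "\<exists>k\<le>r. C = staircase r k"
  then obtain k where k: "C = staircase r k" by blast
  have "\<not> vertex_cover (staircase_graph (2 * r + 1)) D" if D: "D \<subset> staircase r k" for D
  proof
    assume "vertex_cover (staircase_graph (2 * r + 1)) D"
    then obtain j where "staircase r j \<subset> staircase r k"
      using vertex_cover_contains_staircase D by (metis subset_psubset_trans)
    then have "card (staircase r j) < card (staircase r k)"
      by (rule psubset_card_mono[OF finite_staircase])
    then show False by (simp add: card_staircase)
  qed
  then show "minimal_vertex_cover (staircase_graph (2 * r + 1)) C"
    using vertex_cover_staircase k unfolding minimal_vertex_cover_def by blast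
qed

lemma unmixed_staircase_graph: "unmixed (staircase_graph (2 * r + 1))"
  unfolding unmixed_def minimal_vertex_cover_iff_staircase by (auto simp: card_staircase)

lemma vertex_cover_ideal_staircase_graph:
  "(vertex_cover_ideal (staircase_graph (2 * r + 1)) :: (nat \<times> nat, 'k::comm_ring_1) mpoly set)
    = pfaffian_ideal_X3 (2 * r + 1)"
proof -
  have "{\<Prod>v\<in>C. Var v :: (nat \<times> nat, 'k) mpoly | C.
      minimal_vertex_cover (staircase_graph (2 * r + 1)) C}
    = {\<Prod>v\<in>staircase r k. Var v | k. k \<le> r}"
    unfolding minimal_vertex_cover_iff_staircase by blast
  then show ?thesis
    by (simp only: vertex_cover_ideal_def pfaffian_ideal_X3_eq pverts_staircase_graph)
qed

theorem corollary3p5: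
  fixes n r :: nat
  assumes "n = 2 * r + 1"
  shows "\<exists>G :: (nat \<times> nat) pair_pre_digraph.
    pair_graph G \<and> pverts G = x_vars n \<and> bipartite G \<and> unmixed G \<and>
    (vertex_cover_ideal G :: (nat \<times> nat, 'k::field_char_0) mpoly set) = pfaffian_ideal_X3 n"
  unfolding assms
  using pair_graph_staircase_graph pverts_staircase_graph bipartite_staircase_graph
    unmixed_staircase_graph vertex_cover_ideal_staircase_graph
  by blast

end
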